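(* Let $a\ge1$, $b,c\ge0$ and $n=a+b+c$. Let $K(a1^bc)$ be the barbell graph with vertices $r_1,\dots,r_a,s_1,\dots,s_b,t_1,\dots,t_c$ in which $\{r_1,\dots,r_a\}$ is a clique, $r_as_1s_2\cdots s_b$ is a path, and $\{s_b,t_1,\dots,t_c\}$ is a clique, where $s_b$ is to be read as $r_a$ if $b=0$. Then \[ X_{K(a1^bc)}=(a-1)!\,c!\Biggl(\sum_{\substack{I\vDash n,\ i_{-1}\ge a\\ i_1\ge c+1}}w_Ie_I+\sum_{\substack{I\vDash n,\ i_{-1}\ge a\\ i_1\le c<i_2}}(i_2-i_1)\prod_{j\ge3}(i_j-1)\,e_I\Biggr). \]
   Context: A composition $I=i_1\cdots i_s\vDash n$ is a sequence of positive integers with sum $n$; $i_{-1}=i_s$ is the last part; $e_I=e_{i_1}\cdots e_{i_s}$ (elementary symmetric functions); $w_I=i_1\prod_{j\ge2}(i_j-1)$. In the second sum, compositions have at least two parts. The chromatic symmetric function of a graph $G$ is $X_G=\sum_\kappa\prod_{v\in V(G)}x_{\kappa(v)}$ over proper colorings $\kappa:V(G)\to\{1,2,\dots\}$. *)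

theory Defs
  imports Complex_Main "HOL-Library.Multiset" "HOL-Library.FuncSet"
begin

text \<open>
  Formal power series in countably many commuting variables: a monomial is the finite
  multiset of its variable indices, and a series is an arbitrary function from monomials
  to coefficients.
\<close>

typedef 'a mseries = "UNIV :: (nat multiset \<Rightarrow> 'a) set"
  morphisms mcoeff Abs_mseries
  by simp

setup_lifting type_definition_mseries

lemma mseries_eqI: "(\<And>M. mcoeff f M = mcoeff g M) \<Longrightarrow> f = g"
  by transfer auto

lemma finite_submultisets [simp]: "finite {P. P \<subseteq># M}"
proof (rule finite_subset)
  show "{P. P \<subseteq># M} \<subseteq> mset ` {xs. set xs \<subseteq> set_mset M \<and> length xs \<le> size M}"
  proof
    fix P assume "P \<in> {P. P \<subseteq># M}"
    moreover obtain xs where "mset xs = P" using ex_mset by blast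
    ultimately show "P \<in> mset ` {xs. set xs \<subseteq> set_mset M \<and> length xs \<le> size M}"
      by (metis (mono_tags, lifting) image_eqI mem_Collect_eq set_mset_mono set_mset_mset
          size_mset size_mset_mono)
  qed
  show "finite (mset ` {xs. set xs \<subseteq> set_mset M \<and> length xs \<le> size M})"
    by (intro finite_imageI finite_lists_length_le) simp
qed

instantiation mseries :: (comm_ring_1) comm_ring_1
begin

lift_definition zero_mseries :: "'a mseries" is "\<lambda>_. 0" .

lift_definition one_mseries :: "'a mseries" is "\<lambda>M. if M = {#} then 1 else 0" .

lift_definition plus_mseries :: "'a mseries \<Rightarrow> 'a mseries \<Rightarrow> 'a mseries"
  is "\<lambda>f g M. f M + g M" .

lift_definition minus_mseries :: "'a mseries \<Rightarrow> 'a mseries \<Rightarrow> 'a mseries"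
  is "\<lambda>f g M. f M - g M" .

lift_definition uminus_mseries :: "'a mseries \<Rightarrow> 'a mseries"
  is "\<lambda>f M. - f M" .

lift_definition times_mseries :: "'a mseries \<Rightarrow> 'a mseries \<Rightarrow> 'a mseries"
  is "\<lambda>f g M. \<Sum>P \<in> {P. P \<subseteq># M}. f P * g (M - P)" .

instance
proof
  fix f g h :: "'a mseries"
  show "f * g * h = f * (g * h)"
  proof (rule mseries_eqI, transfer)
    fix f g h :: "nat multiset \<Rightarrow> 'a" and M
    have "(\<Sum>P | P \<subseteq># M. (\<Sum>Q | Q \<subseteq># P. f Q * g (P - Q)) * h (M - P))
        = (\<Sum>(P, Q) \<in> (SIGMA P:{P. P \<subseteq># M}. {Q. Q \<subseteq># P}). f Q * g (P - Q) * h (M - P))"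
      by (simp add: sum.Sigma sum_distrib_right)
    also have "\<dots> = (\<Sum>(Q, R) \<in> (SIGMA Q:{Q. Q \<subseteq># M}. {R. R \<subseteq># M - Q}).
        f Q * (g R * h (M - Q - R)))"
      by (rule sum.reindex_bij_witness[where i = "\<lambda>(Q, R). (Q + R, Q)"
              and j = "\<lambda>(P, Q). (Q, P - Q)"])
         (auto simp: mult.assoc subset_mset.add_diff_inverse subset_mset.le_diff_conv2
            subset_mset.diff_add add.commute
            intro: subset_mset.order_trans subset_eq_diff_conv)
    also have "\<dots> = (\<Sum>Q | Q \<subseteq># M. f Q * (\<Sum>R | R \<subseteq># M - Q. g R * h (M - Q - R)))"
      by (simp add: sum.Sigma sum_distrib_left)
    finally show "(\<Sum>P | P \<subseteq># M. (\<Sum>Q | Q \<subseteq># P. f Q * g (P - Q)) * h (M - P))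
        = (\<Sum>Q | Q \<subseteq># M. f Q * (\<Sum>R | R \<subseteq># M - Q. g R * h (M - Q - R)))" .
  qed
  show "f * g = g * f"
  proof (rule mseries_eqI, transfer)
    fix f g :: "nat multiset \<Rightarrow> 'a" and M
    show "(\<Sum>P | P \<subseteq># M. f P * g (M - P)) = (\<Sum>P | P \<subseteq># M. g P * f (M - P))"
      by (rule sum.reindex_bij_witness[where i = "\<lambda>P. M - P" and j = "\<lambda>P. M - P"])
         (auto simp: mult.commute subset_mset.diff_diff_right)
  qed
  show "1 * f = f"
  proof (rule mseries_eqI, transfer)
    fix f :: "nat multiset \<Rightarrow> 'a" and M
    have "(\<Sum>P | P \<subseteq># M. (if P = {#} then 1 else 0) * f (M - P))
        = (\<Sum>P \<in> {{#}}. (if P = {#} then 1 else 0) * f (M - P))"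
      by (rule sum.mono_neutral_right) auto
    then show "(\<Sum>P | P \<subseteq># M. (if P = {#} then 1 else 0) * f (M - P)) = f M"
      by simp
  qed
  show "(f + g) * h = f * h + g * h"
    by (rule mseries_eqI, transfer) (simp add: algebra_simps sum.distrib)
  show "(0 :: 'a mseries) \<noteq> 1"
    by transfer (metis zero_neq_one)
qed (transfer; simp add: algebra_simps; fail)+

end

lift_definition var :: "nat \<Rightarrow> 'a::comm_ring_1 mseries"
  is "\<lambda>i M. if M = {#i#} then 1 else 0" .

text \<open>
  The sum of a possibly infinite family of series, taken coefficientwise; it is meaningful
  when every monomial occurs in only finitely many members of the family.
\<close>

lift_definition formal_sum :: "'i set \<Rightarrow> ('i \<Rightarrow> 'a::comm_ring_1 mseries) \<Rightarrow> 'a mseries"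
  is "\<lambda>A f M. \<Sum>i | i \<in> A \<and> f i M \<noteq> 0. f i M" .

definition elem_sym :: "nat \<Rightarrow> 'a::comm_ring_1 mseries" where
  "elem_sym k = formal_sum {A. A \<subseteq> {1..} \<and> finite A \<and> card A = k} (\<lambda>A. \<Prod>i\<in>A. var i)"

definition elem_sym_list :: "nat list \<Rightarrow> 'a::comm_ring_1 mseries" where
  "elem_sym_list I = (\<Prod>i\<leftarrow>I. elem_sym i)"

definition proper_colorings :: "'v set \<Rightarrow> 'v set set \<Rightarrow> ('v \<Rightarrow> nat) set" where
  "proper_colorings V E = {\<kappa> \<in> V \<rightarrow>\<^sub>E {1..}. \<forall>u\<in>V. \<forall>v\<in>V. {u, v} \<in> E \<longrightarrow> \<kappa> u \<noteq> \<kappa> v}"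

definition chromatic_sym :: "'v set \<Rightarrow> 'v set set \<Rightarrow> 'a::comm_ring_1 mseries" where
  "chromatic_sym V E = formal_sum (proper_colorings V E) (\<lambda>\<kappa>. \<Prod>v\<in>V. var (\<kappa> v))"

definition compositions :: "nat \<Rightarrow> nat list set" where
  "compositions n = {I. (\<forall>i\<in>set I. i \<ge> 1) \<and> sum_list I = n}"

definition comp_weight :: "nat list \<Rightarrow> int" where
  "comp_weight I = int (hd I) * (\<Prod>i\<leftarrow>tl I. int i - 1)"

datatype barbell_vertex = R nat | S nat | T nat

text \<open>The vertex \<open>s\<^sub>j\<close>, with \<open>s\<^sub>0\<close> read as \<open>r\<^sub>a\<close>.\<close>

definition barbell_path_vertex :: "nat \<Rightarrow> nat \<Rightarrow> barbell_vertex" where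
  "barbell_path_vertex a j = (if j = 0 then R a else S j)"

definition clique_edges :: "'v set \<Rightarrow> 'v set set" where
  "clique_edges C = {{u, v} | u v. u \<in> C \<and> v \<in> C \<and> u \<noteq> v}"

definition barbell_verts :: "nat \<Rightarrow> nat \<Rightarrow> nat \<Rightarrow> barbell_vertex set" where
  "barbell_verts a b c = R ` {1..a} \<union> S ` {1..b} \<union> T ` {1..c}"

definition barbell_edges :: "nat \<Rightarrow> nat \<Rightarrow> nat \<Rightarrow> barbell_vertex set set" where
  "barbell_edges a b c =
     clique_edges (R ` {1..a})
     \<union> {{barbell_path_vertex a j, barbell_path_vertex a (Suc j)} | j. j < b}
     \<union> clique_edges (insert (barbell_path_vertex a b) (T ` {1..c}))"

lemma prod_var_eq:
  assumes "finite A"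
  shows "mcoeff (\<Prod>i\<in>A. var (f i) :: 'a::comm_ring_1 mseries) M
           = (if M = image_mset f (mset_set A) then 1 else 0)"
  using assms
proof (induction A arbitrary: M rule: finite_induct)
  case empty
  show ?case by (simp add: one_mseries.rep_eq)
next
  case (insert x A)
  have "mcoeff (\<Prod>i\<in>insert x A. var (f i) :: 'a mseries) M
      = (\<Sum>P | P \<subseteq># M. (if P = {#f x#} then 1 else 0) *
            (if M - P = image_mset f (mset_set A) then 1 else 0))"
    using insert by (simp add: times_mseries.rep_eq var.rep_eq)
  also have "\<dots> = (\<Sum>P \<in> {P. P \<subseteq># M} \<inter> {{#f x#}}.
            (if M - P = image_mset f (mset_set A) then 1 else 0))"
    by (rule sum.mono_neutral_cong_right) auto
  also have "\<dots> = (if M = image_mset f (mset_set (insert x A)) then 1 else 0)"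
  proof (cases "f x \<in># M")
    case True
    then obtain N where "M = add_mset (f x) N" by (metis insert_DiffM)
    then show ?thesis using insert by simp
  next
    case False
    then have "{P. P \<subseteq># M} \<inter> {{#f x#}} = {}" by auto
    moreover have "M \<noteq> image_mset f (mset_set (insert x A))" using False insert by auto
    ultimately show ?thesis by simp
  qed
  finally show ?case .
qed

lemma finite_elem_sym_support:
  "finite {A. (A \<subseteq> {1..} \<and> finite A \<and> card A = k)
              \<and> mcoeff (\<Prod>i\<in>A. var i :: 'a::comm_ring_1 mseries) M \<noteq> 0}"
  by (rule finite_subset[of _ "Pow (set_mset M)"])
     (auto simp: prod_var_eq split: if_splits)

lemma finite_chromatic_support:
  assumes "finite V"
  shows "finite {\<kappa>. \<kappa> \<in> proper_colorings V E
              \<and> mcoeff (\<Prod>v\<in>V. var (\<kappa> v) :: 'a::comm_ring_1 mseries) M \<noteq> 0}"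
proof (rule finite_subset)
  show "finite (V \<rightarrow>\<^sub>E set_mset M)"
    using assms by (intro finite_PiE) auto
qed (use assms in \<open>auto simp: proper_colorings_def prod_var_eq PiE_def split: if_splits\<close>)

lemma finite_compositions: "finite (compositions n)"
proof (rule finite_subset)
  have "length I \<le> sum_list I" if "\<forall>i\<in>set I. i \<ge> 1" for I :: "nat list"
    using that by (induction I) auto
  then show "compositions n \<subseteq> {I. set I \<subseteq> {..n} \<and> length I \<le> n}"
    by (auto simp: compositions_def dest: member_le_sum_list)
  show "finite {I. set I \<subseteq> {..n} \<and> length I \<le> n}"
    by (rule finite_lists_length_le) simp
qed

end

theory Submission
  imports Defs
begin

text \<open>
  Fix a finite set \<open>C\<close> of colours and write \<open>e\<^sub>k(C)\<close> for the elementary symmetric polynomial in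
  the variables \<open>x\<^sub>i\<close>, \<open>i \<in> C\<close>. Sorting the proper colourings by the colour \<open>i\<close> of the last path
  vertex \<open>s\<^sub>b\<close> gives \<open>X = (a - 1)! c! Y(b, c)\<close> with \<open>Y(b, c) = \<Sum>i. W\<^sub>b(i) e\<^sub>c(C - i)\<close>, where \<open>W\<^sub>b(i)\<close>
  sums the colourings of the lollipop in which \<open>s\<^sub>b\<close> has colour \<open>i\<close>, divided by \<open>(a - 1)!\<close>.
  From \<open>W\<^sub>b\<^sub>+\<^sub>1(i) = x\<^sub>i (\<Sum>j. W\<^sub>b(j) - W\<^sub>b(i))\<close>, \<open>x\<^sub>i e\<^sub>c(C - i) = e\<^sub>c\<^sub>+\<^sub>1(C) - e\<^sub>c\<^sub>+\<^sub>1(C - i)\<close> and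
  \<open>\<Sum>i. x\<^sub>i e\<^sub>c(C - i) = (c + 1) e\<^sub>c\<^sub>+\<^sub>1(C)\<close> one obtains
  \<open>Y(b + 1, c) = Y(b, c + 1) + c e\<^sub>c\<^sub>+\<^sub>1(C) Y(b, 0)\<close>. The sum over compositions obeys the same
  recursion: the coefficients for \<open>c\<close> and \<open>c + 1\<close> differ only on compositions whose first or second
  part is \<open>c + 1\<close>, and deleting this part leads to compositions of \<open>n - c - 1\<close>. The passage to
  infinitely many colours is coefficientwise, since a monomial involves only finitely many variables.
\<close>

subsection \<open>Elementary symmetric polynomials and injective colourings\<close>

definition esym :: "('c \<Rightarrow> 'a::comm_ring_1) \<Rightarrow> 'c set \<Rightarrow> nat \<Rightarrow> 'a" where
  "esym x C k = (\<Sum>A | A \<subseteq> C \<and> card A = k. \<Prod>i\<in>A. x i)"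

lemma esym_0:
  assumes "finite C"
  shows "esym x C 0 = 1"
proof -
  have "{A. A \<subseteq> C \<and> card A = 0} = {{}}"
    using assms by (auto dest: finite_subset)
  then show ?thesis by (simp add: esym_def)
qed

text \<open>A set of size \<open>Suc k\<close> either avoids \<open>i\<close> or arises by inserting
  \<open>i\<close> into a \<open>k\<close>-subset of \<open>C - {i}\<close>.\<close>

lemma esym_Suc_remove:
  assumes "finite C" "i \<in> C"
  shows "esym x C (Suc k) = esym x (C - {i}) (Suc k) + x i * esym x (C - {i}) k"
proof -
  let ?P = "{A. A \<subseteq> C - {i} \<and> card A = Suc k}" and ?Q = "{A. A \<subseteq> C - {i} \<and> card A = k}"
  have split: "{A. A \<subseteq> C \<and> card A = Suc k} = ?P \<union> insert i ` ?Q"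
  proof (intro equalityI subsetI)
    fix A assume "A \<in> {A. A \<subseteq> C \<and> card A = Suc k}"
    then have A: "A \<subseteq> C" "card A = Suc k" "finite A"
      using assms finite_subset by auto
    show "A \<in> ?P \<union> insert i ` ?Q"
    proof (cases "i \<in> A")
      case True
      then have "A = insert i (A - {i})" "A - {i} \<in> ?Q" using A by auto
      then show ?thesis by blast
    qed (use A in auto)
  next
    fix A assume "A \<in> ?P \<union> insert i ` ?Q"
    then consider "A \<in> ?P" | B where "A = insert i B" "B \<in> ?Q" by blast
    then show "A \<in> {A. A \<subseteq> C \<and> card A = Suc k}"
    proof cases
      case 2
      then have "finite B" "i \<notin> B" using assms finite_subset by auto
      then show ?thesis using 2 assms by auto
    qed auto
  qed
  have inj: "inj_on (insert i) ?Q"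
    by (rule inj_onI) (metis (no_types, lifting) Diff_insert_absorb mem_Collect_eq
        subset_Diff_insert)
  have fin: "finite ?P" "finite ?Q" using assms by auto
  have "esym x C (Suc k) = (\<Sum>A\<in>?P. \<Prod>j\<in>A. x j) + (\<Sum>A\<in>insert i ` ?Q. \<Prod>j\<in>A. x j)"
    unfolding esym_def split using fin by (intro sum.union_disjoint) auto
  also have "(\<Sum>A\<in>insert i ` ?Q. \<Prod>j\<in>A. x j) = (\<Sum>A\<in>?Q. x i * (\<Prod>j\<in>A. x j))"
    unfolding sum.reindex[OF inj] o_def
  proof (rule sum.cong)
    fix A assume "A \<in> ?Q"
    then have "finite A" "i \<notin> A" using assms finite_subset by auto
    then show "(\<Prod>j\<in>insert i A. x j) = x i * (\<Prod>j\<in>A. x j)" by simp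
  qed simp
  finally show ?thesis by (simp add: esym_def sum_distrib_left)
qed

text \<open>Double counting: choosing \<open>i\<close> and then a \<open>k\<close>-set avoiding it
  amounts to choosing a set \<open>B\<close> of size \<open>Suc k\<close> with a marked element, and
  each \<open>B\<close> has \<open>Suc k\<close> markings.\<close>

lemma sum_var_esym_remove:
  assumes "finite C"
  shows "(\<Sum>i\<in>C. x i * esym x (C - {i}) k) = of_nat (Suc k) * esym x C (Suc k)"
proof -
  let ?Q = "\<lambda>i. {A. A \<subseteq> C - {i} \<and> card A = k}"
  let ?P = "{B. B \<subseteq> C \<and> card B = Suc k}"
  have fin: "finite B" if "B \<subseteq> C" for B using that assms finite_subset by blast
  have "(\<Sum>i\<in>C. x i * esym x (C - {i}) k)
      = (\<Sum>(i, A)\<in>(SIGMA i:C. ?Q i). x i * (\<Prod>j\<in>A. x j))"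
    using assms by (simp add: esym_def sum_distrib_left sum.Sigma)
  also have "\<dots> = (\<Sum>(B, i)\<in>(SIGMA B:?P. B). \<Prod>j\<in>B. x j)"
  proof (rule sum.reindex_bij_witness[where i = "\<lambda>(B, i). (i, B - {i})"
        and j = "\<lambda>(i, A). (insert i A, i)"])
    fix p assume "p \<in> (SIGMA i:C. ?Q i)"
    then obtain i A where p: "p = (i, A)" "i \<in> C" "A \<subseteq> C - {i}" "card A = k" by auto
    then have "finite A" "i \<notin> A" using fin by auto
    then show "(case case p of (i, A) \<Rightarrow> (insert i A, i) of (B, i) \<Rightarrow> (i, B - {i})) = p"
      "(case p of (i, A) \<Rightarrow> (insert i A, i)) \<in> (SIGMA B:?P. B)"
      "(case case p of (i, A) \<Rightarrow> (insert i A, i) of (B, i) \<Rightarrow> \<Prod>j\<in>B. x j)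
        = (case p of (i, A) \<Rightarrow> x i * (\<Prod>j\<in>A. x j))"
      using p by auto
  next
    fix q assume "q \<in> (SIGMA B:?P. B)"
    then obtain i B where q: "q = (B, i)" "i \<in> B" "B \<subseteq> C" "card B = Suc k" by auto
    then show "(case case q of (B, i) \<Rightarrow> (i, B - {i}) of (i, A) \<Rightarrow> (insert i A, i)) = q"
      "(case q of (B, i) \<Rightarrow> (i, B - {i})) \<in> (SIGMA i:C. ?Q i)"
      using fin by auto
  qed
  also have "\<dots> = (\<Sum>B\<in>?P. \<Sum>i\<in>B. \<Prod>j\<in>B. x j)"
    using assms fin by (subst sum.Sigma) auto
  also have "\<dots> = (\<Sum>B\<in>?P. of_nat (Suc k) * (\<Prod>j\<in>B. x j))"
    by (rule sum.cong) auto
  finally show ?thesis by (simp add: esym_def sum_distrib_left)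
qed

text \<open>Evaluates the barbell with b = 0, two cliques sharing a vertex of colour
  \<open>i\<close>. Using \<open>esym_Suc_remove\<close> for each factor moves one unit from
  \<open>q\<close> to \<open>p\<close>; every move leaves behind a product of polynomials in all of
  \<open>C\<close>, and at q = 0 only \<open>sum_var_esym_remove\<close> remains.\<close>

lemma sum_var_esym_esym_remove:
  fixes x :: "'c \<Rightarrow> 'a::comm_ring_1"
  assumes "finite C"
  shows "(\<Sum>i\<in>C. x i * esym x (C - {i}) p * esym x (C - {i}) q)
    = of_nat (p + q + 1) * esym x C (p + q + 1)
      + (\<Sum>r = 1..q. of_int (int (p + q + 1) - 2 * int r) * (esym x C r * esym x C (p + q + 1 - r)))"
proof (induction q arbitrary: p)
  case 0
  then show ?case
    using assms sum_var_esym_remove[OF assms, of x p] by (simp add: esym_0)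
next
  case (Suc q)
  \<comment> \<open>First \<open>e_(q+1)(C - i) = e_(q+1)(C) - x_i e_q(C - i)\<close>, then
    \<open>x_i e_p(C - i) = e_(p+1)(C) - e_(p+1)(C - i)\<close> in the product so obtained.\<close>
  have "(\<Sum>i\<in>C. x i * esym x (C - {i}) p * esym x (C - {i}) (Suc q))
      = (\<Sum>i\<in>C. (x i * esym x (C - {i}) p) * esym x C (Suc q)
         - (x i * esym x (C - {i}) q) * esym x C (Suc p)
         + x i * esym x (C - {i}) (Suc p) * esym x (C - {i}) q)"
    by (rule sum.cong)
       (simp_all add: esym_Suc_remove[OF assms, of _ x p] esym_Suc_remove[OF assms, of _ x q]
          algebra_simps)
  also have "\<dots> = of_nat (Suc p) * esym x C (Suc p) * esym x C (Suc q)
      - of_nat (Suc q) * esym x C (Suc q) * esym x C (Suc p)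
      + (\<Sum>i\<in>C. x i * esym x (C - {i}) (Suc p) * esym x (C - {i}) q)"
    by (simp only: sum.distrib sum_subtractf sum_var_esym_remove[OF assms]
        flip: sum_distrib_right)
  \<comment> \<open>This is the summand \<open>r = Suc q\<close>: its coefficient is (p + q + 2) -
    2(q + 1) = p - q.\<close>
  also have "\<dots> = of_int (int p - int q) * (esym x C (Suc q) * esym x C (Suc p))
      + (\<Sum>i\<in>C. x i * esym x (C - {i}) (Suc p) * esym x (C - {i}) q)"
    by (simp add: algebra_simps)
  finally show ?case
    unfolding Suc.IH by (simp add: add.left_commute)
qed

section \<open>Splitting sums over colourings\<close>

lemma sum_PiE_Un:
  assumes "A \<inter> B = {}"
  shows "(\<Sum>\<kappa>\<in>A \<union> B \<rightarrow>\<^sub>E C. f \<kappa>)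
    = (\<Sum>\<alpha>\<in>A \<rightarrow>\<^sub>E C. \<Sum>\<beta>\<in>B \<rightarrow>\<^sub>E C. f (\<lambda>v. if v \<in> A then \<alpha> v else \<beta> v))"
  unfolding sum.cartesian_product
proof (rule sum.reindex_bij_witness[where
      i = "\<lambda>(\<alpha>, \<beta>) v. if v \<in> A then \<alpha> v else \<beta> v"
      and j = "\<lambda>\<kappa>. (restrict \<kappa> A, restrict \<kappa> B)"])
  fix \<kappa> assume "\<kappa> \<in> A \<union> B \<rightarrow>\<^sub>E C"
  then show "(case (restrict \<kappa> A, restrict \<kappa> B) of (\<alpha>, \<beta>) \<Rightarrow> \<lambda>v. if v \<in> A then \<alpha> v else \<beta> v) = \<kappa>"
    by (auto simp: PiE_def extensional_def fun_eq_iff restrict_def)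
  then show "(case (restrict \<kappa> A, restrict \<kappa> B) of
        (\<alpha>, \<beta>) \<Rightarrow> f (\<lambda>v. if v \<in> A then \<alpha> v else \<beta> v)) = f \<kappa>"
    by simp
next
  fix p assume "p \<in> (A \<rightarrow>\<^sub>E C) \<times> (B \<rightarrow>\<^sub>E C)"
  then obtain \<alpha> \<beta> where p: "p = (\<alpha>, \<beta>)" "\<alpha> \<in> A \<rightarrow>\<^sub>E C" "\<beta> \<in> B \<rightarrow>\<^sub>E C" by auto
  have "v \<in> B \<Longrightarrow> v \<notin> A" for v using assms by auto
  with p show "(restrict (case p of (\<alpha>, \<beta>) \<Rightarrow> \<lambda>v. if v \<in> A then \<alpha> v else \<beta> v) A,
        restrict (case p of (\<alpha>, \<beta>) \<Rightarrow> \<lambda>v. if v \<in> A then \<alpha> v else \<beta> v) B) = p"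
    by (auto simp: PiE_def extensional_def fun_eq_iff restrict_def)
  show "(case p of (\<alpha>, \<beta>) \<Rightarrow> \<lambda>v. if v \<in> A then \<alpha> v else \<beta> v) \<in> A \<union> B \<rightarrow>\<^sub>E C"
    using p by (auto simp: PiE_def extensional_def)
qed (auto simp: PiE_def)

lemma sum_PiE_insert:
  assumes "u \<notin> K"
  shows "(\<Sum>\<kappa>\<in>insert u K \<rightarrow>\<^sub>E C. f \<kappa>) = (\<Sum>i\<in>C. \<Sum>\<kappa>\<in>K \<rightarrow>\<^sub>E C. f (\<kappa>(u := i)))"
proof -
  have "(\<Sum>\<kappa>\<in>insert u K \<rightarrow>\<^sub>E C. f \<kappa>)
      = (\<Sum>p\<in>C \<times> (K \<rightarrow>\<^sub>E C). f ((\<lambda>(i, \<kappa>). \<kappa>(u := i)) p))"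
    unfolding PiE_insert_eq using inj_combinator[OF assms, of "\<lambda>_. C"]
    by (simp add: sum.reindex)
  then show ?thesis by (simp add: sum.cartesian_product case_prod_unfold)
qed

lemma colorings_agree:
  assumes "\<And>v. v \<in> K \<Longrightarrow> \<kappa> v = \<kappa>' v"
  shows "inj_on \<kappa> K = inj_on \<kappa>' K" "\<kappa> ` K = \<kappa>' ` K"
    "(\<Prod>v\<in>K. x (\<kappa> v)) = (\<Prod>v\<in>K. x (\<kappa>' v))"
  using assms by (auto cong: inj_on_cong image_cong prod.cong)

lemma sum_avoiding_injective:
  fixes x :: "'c \<Rightarrow> 'a::comm_ring_1"
  assumes "finite C" "finite K"
  shows "(\<Sum>\<kappa>\<in>K \<rightarrow>\<^sub>E C. if inj_on \<kappa> K \<and> i \<notin> \<kappa> ` K then \<Prod>v\<in>K. x (\<kappa> v) else 0)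
      = (\<Sum>\<kappa>\<in>K \<rightarrow>\<^sub>E C - {i}. if inj_on \<kappa> K then \<Prod>v\<in>K. x (\<kappa> v) else 0)"
proof (rule sum.mono_neutral_cong_right)
  show "finite (K \<rightarrow>\<^sub>E C)" using assms by (intro finite_PiE) auto
qed (auto simp: PiE_def Pi_def)

text \<open>Each set of \<open>card K\<close> colours is the image of \<open>fact (card K)\<close>
  injective colourings. The induction fixes the colour \<open>i\<close> of one vertex, which the
  others then avoid, so \<open>C\<close> varies; the next factor of the factorial comes from
  \<open>sum_var_esym_remove\<close>.\<close>

lemma sum_injective_colorings:
  fixes x :: "'c \<Rightarrow> 'a::comm_ring_1"
  assumes "finite K" "finite C"
  shows "(\<Sum>\<kappa>\<in>K \<rightarrow>\<^sub>E C. if inj_on \<kappa> K then \<Prod>v\<in>K. x (\<kappa> v) else 0)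
    = of_nat (fact (card K)) * esym x C (card K)"
  using assms
proof (induction K arbitrary: C rule: finite_induct)
  case empty
  then show ?case by (simp add: esym_0)
next
  case (insert u K)
  have "(\<Sum>\<kappa>\<in>insert u K \<rightarrow>\<^sub>E C. if inj_on \<kappa> (insert u K) then \<Prod>v\<in>insert u K. x (\<kappa> v) else 0)
     = (\<Sum>i\<in>C. \<Sum>\<kappa>\<in>K \<rightarrow>\<^sub>E C. x i * (if inj_on \<kappa> K \<and> i \<notin> \<kappa> ` K then \<Prod>v\<in>K. x (\<kappa> v) else 0))"
    unfolding sum_PiE_insert[OF insert.hyps(2)]
  proof (intro sum.cong refl)
    fix i :: 'c and \<kappa> :: "'b \<Rightarrow> 'c"
    have "\<And>v. v \<in> K \<Longrightarrow> (\<kappa>(u := i)) v = \<kappa> v" using insert.hyps(2) by auto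
    note agree = colorings_agree[of K "\<kappa>(u := i)" \<kappa>, OF this]
    show "(if inj_on (\<kappa>(u := i)) (insert u K) then \<Prod>v\<in>insert u K. x ((\<kappa>(u := i)) v) else 0)
      = x i * (if inj_on \<kappa> K \<and> i \<notin> \<kappa> ` K then \<Prod>v\<in>K. x (\<kappa> v) else 0)"
      using insert.hyps agree(1,2) agree(3)[of x] by (simp add: inj_on_insert)
  qed
  also have "\<dots> = (\<Sum>i\<in>C. x i * (of_nat (fact (card K)) * esym x (C - {i}) (card K)))"
    using insert by (simp add: sum_avoiding_injective flip: sum_distrib_left)
  also have "\<dots> = of_nat (fact (card K)) * (\<Sum>i\<in>C. x i * esym x (C - {i}) (card K))"
    by (simp add: sum_distrib_left algebra_simps)
  also have "\<dots> = of_nat (fact (card (insert u K))) * esym x C (card (insert u K))"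
    unfolding sum_var_esym_remove[OF insert.prems] using insert.hyps
    by (simp add: algebra_simps)
  finally show ?case .
qed

lemma sum_injective_colorings_avoiding:
  fixes x :: "'c \<Rightarrow> 'a::comm_ring_1"
  assumes "finite K" "finite C"
  shows "(\<Sum>\<kappa>\<in>K \<rightarrow>\<^sub>E C. if inj_on \<kappa> K \<and> i \<notin> \<kappa> ` K then \<Prod>v\<in>K. x (\<kappa> v) else 0)
    = of_nat (fact (card K)) * esym x (C - {i}) (card K)"
  using assms by (simp add: sum_avoiding_injective sum_injective_colorings)

subsection \<open>Colourings of barbells\<close>

text \<open>Properness in a form that splits along the graph into clique, path, clique. For
  \<open>c = 0\<close> the last conjunct is vacuous and the graph is a lollipop.\<close>

definition barbell_proper :: "nat \<Rightarrow> nat \<Rightarrow> nat \<Rightarrow> (barbell_vertex \<Rightarrow> 'c) \<Rightarrow> bool" where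
  "barbell_proper a b c \<kappa> \<longleftrightarrow>
     inj_on \<kappa> (R ` {1..a})
     \<and> (\<forall>j<b. \<kappa> (barbell_path_vertex a j) \<noteq> \<kappa> (barbell_path_vertex a (Suc j)))
     \<and> inj_on \<kappa> (insert (barbell_path_vertex a b) (T ` {1..c}))"

lemma proper_on_clique_iff:
  assumes "K \<subseteq> V"
  shows "(\<forall>u\<in>V. \<forall>v\<in>V. {u, v} \<in> clique_edges K \<longrightarrow> \<kappa> u \<noteq> \<kappa> v) \<longleftrightarrow> inj_on \<kappa> K"
  using assms by (fastforce simp: clique_edges_def inj_on_def doubleton_eq_iff)

lemma barbell_path_vertex_mem:
  assumes "a \<ge> 1" "j \<le> b"
  shows "barbell_path_vertex a j \<in> barbell_verts a b c"
  using assms by (auto simp: barbell_path_vertex_def barbell_verts_def)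

lemma barbell_proper_iff:
  assumes "a \<ge> 1"
  shows "(\<forall>u\<in>barbell_verts a b c. \<forall>v\<in>barbell_verts a b c.
            {u, v} \<in> barbell_edges a b c \<longrightarrow> \<kappa> u \<noteq> \<kappa> v) \<longleftrightarrow> barbell_proper a b c \<kappa>"
proof -
  let ?V = "barbell_verts a b c" and ?p = "barbell_path_vertex a"
  let ?E = "{{?p j, ?p (Suc j)} | j. j < b}"
  have R: "R ` {1..a} \<subseteq> ?V" and T: "insert (?p b) (T ` {1..c}) \<subseteq> ?V"
    using barbell_path_vertex_mem[OF assms, of b b] by (auto simp: barbell_verts_def)
  have p: "?p j \<in> ?V" if "j \<le> b" for j using that by (rule barbell_path_vertex_mem[OF assms])
  have path: "(\<forall>u\<in>?V. \<forall>v\<in>?V. {u, v} \<in> ?E \<longrightarrow> \<kappa> u \<noteq> \<kappa> v)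
      \<longleftrightarrow> (\<forall>j<b. \<kappa> (?p j) \<noteq> \<kappa> (?p (Suc j)))" (is "?l \<longleftrightarrow> ?r")
  proof
    assume l: ?l
    show ?r
    proof (intro allI impI)
      fix j assume "j < b"
      then have "?p j \<in> ?V" "?p (Suc j) \<in> ?V" "{?p j, ?p (Suc j)} \<in> ?E" using p by auto
      then show "\<kappa> (?p j) \<noteq> \<kappa> (?p (Suc j))" using l by blast
    qed
  next
    assume ?r
    then show ?l by (fastforce simp: doubleton_eq_iff)
  qed
  show ?thesis
    unfolding barbell_proper_def path[symmetric] proper_on_clique_iff[OF R, symmetric]
      proper_on_clique_iff[OF T, symmetric] barbell_edges_def
    by blast
qed

text \<open>The edge condition quantifies over vertices only. This lets updated or glued colourings
  be replaced by their pieces.\<close>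

lemma barbell_proper_cong:
  assumes "a \<ge> 1" "\<And>v. v \<in> barbell_verts a b c \<Longrightarrow> \<kappa> v = \<kappa>' v"
  shows "barbell_proper a b c \<kappa> \<longleftrightarrow> barbell_proper a b c \<kappa>'"
  unfolding barbell_proper_iff[OF assms(1), symmetric] using assms(2) by auto

lemma barbell_proper_Suc:
  "barbell_proper a (Suc b) 0 \<kappa> \<longleftrightarrow> barbell_proper a b 0 \<kappa>
     \<and> \<kappa> (barbell_path_vertex a b) \<noteq> \<kappa> (barbell_path_vertex a (Suc b))"
  by (auto simp: barbell_proper_def less_Suc_eq)

lemma finite_barbell_verts: "finite (barbell_verts a b c)"
  by (simp add: barbell_verts_def)

definition barbell_sum :: "('c \<Rightarrow> 'a::comm_ring_1) \<Rightarrow> 'c set \<Rightarrow> nat \<Rightarrow> nat \<Rightarrow> nat \<Rightarrow> 'a" where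
  "barbell_sum x C a b c = (\<Sum>\<kappa>\<in>barbell_verts a b c \<rightarrow>\<^sub>E C.
     if barbell_proper a b c \<kappa> then \<Prod>v\<in>barbell_verts a b c. x (\<kappa> v) else 0)"

text \<open>The \<open>W\<^sub>b(i)\<close> of the overview. The division by
  \<open>fact (a - 1)\<close> is built into the base case, where the clique vertices other than
  \<open>R a\<close> contribute a set of colours instead of an assignment.\<close>

fun lollipop_sum :: "('c \<Rightarrow> 'a::comm_ring_1) \<Rightarrow> 'c set \<Rightarrow> nat \<Rightarrow> nat \<Rightarrow> 'c \<Rightarrow> 'a" where
  "lollipop_sum x C a 0 i = x i * esym x (C - {i}) (a - 1)"
| "lollipop_sum x C a (Suc b) i = x i * (\<Sum>j\<in>C - {i}. lollipop_sum x C a b j)"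

text \<open>Meant for \<open>v\<close> the last path vertex: what is attached there sees the
  colouring only through the colour of \<open>v\<close>, and \<open>h\<close> records its
  effect.\<close>

lemma sum_PiE_by_color:
  fixes h :: "'c \<Rightarrow> 'a::comm_ring_1"
  assumes "finite C" "v \<in> V"
  shows "(\<Sum>\<kappa>\<in>V \<rightarrow>\<^sub>E C. if P \<kappa> then f \<kappa> * h (\<kappa> v) else 0)
    = (\<Sum>i\<in>C. (\<Sum>\<kappa>\<in>V \<rightarrow>\<^sub>E C. if P \<kappa> \<and> \<kappa> v = i then f \<kappa> else 0) * h i)"
proof -
  have "(\<Sum>i\<in>C. (\<Sum>\<kappa>\<in>V \<rightarrow>\<^sub>E C. if P \<kappa> \<and> \<kappa> v = i then f \<kappa> else 0) * h i)
     = (\<Sum>\<kappa>\<in>V \<rightarrow>\<^sub>E C. \<Sum>i\<in>C. if i = \<kappa> v then (if P \<kappa> then f \<kappa> * h i else 0) else 0)"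
    unfolding sum_distrib_right by (subst sum.swap) (auto intro!: sum.cong)
  also have "\<dots> = (\<Sum>\<kappa>\<in>V \<rightarrow>\<^sub>E C. if P \<kappa> then f \<kappa> * h (\<kappa> v) else 0)"
    using assms by (intro sum.cong) (auto simp: PiE_mem)
  finally show ?thesis by simp
qed

text \<open>Induction along the path: a new end vertex of colour \<open>i\<close> contributes
  \<open>x i\<close> and only forbids the colour \<open>i\<close> at the previous end.\<close>

lemma lollipop_coloring_sum:
  fixes x :: "'c \<Rightarrow> 'a::comm_ring_1"
  assumes "finite C" "a \<ge> 1" "i \<in> C"
  shows "(\<Sum>\<kappa>\<in>barbell_verts a b 0 \<rightarrow>\<^sub>E C.
      if barbell_proper a b 0 \<kappa> \<and> \<kappa> (barbell_path_vertex a b) = i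
      then \<Prod>v\<in>barbell_verts a b 0. x (\<kappa> v) else 0)
    = of_nat (fact (a - 1)) * lollipop_sum x C a b i"
  using assms(3)
proof (induction b arbitrary: i)
  case 0
  \<comment> \<open>Without a path the end vertex is \<open>R a\<close>; the other
    \<open>a - 1\<close> clique vertices take distinct colours different from
    \<open>i\<close>.\<close>
  let ?K = "R ` {1..<a}"
  have V: "barbell_verts a 0 0 = insert (R a) ?K" "R ` {1..a} = insert (R a) ?K" "R a \<notin> ?K"
    using assms by (force simp: barbell_verts_def)+
  have card: "card ?K = a - 1" by (simp add: card_image inj_on_def)
  have "finite ?K" by simp
  note inner = sum_injective_colorings_avoiding[OF this assms(1), where x = x and i = i, unfolded card]
  have "(\<Sum>\<kappa>\<in>barbell_verts a 0 0 \<rightarrow>\<^sub>E C.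
      if barbell_proper a 0 0 \<kappa> \<and> \<kappa> (barbell_path_vertex a 0) = i
      then \<Prod>v\<in>barbell_verts a 0 0. x (\<kappa> v) else 0)
    = (\<Sum>j\<in>C. \<Sum>\<kappa>\<in>?K \<rightarrow>\<^sub>E C. if j = i
        then x i * (if inj_on \<kappa> ?K \<and> i \<notin> \<kappa> ` ?K then \<Prod>v\<in>?K. x (\<kappa> v) else 0) else 0)"
    unfolding V(1) sum_PiE_insert[OF V(3)]
  proof (intro sum.cong refl)
    fix j :: 'c and \<kappa> :: "barbell_vertex \<Rightarrow> 'c"
    have "\<And>v. v \<in> ?K \<Longrightarrow> (\<kappa>(R a := j)) v = \<kappa> v" by auto
    note agree = colorings_agree[of ?K "\<kappa>(R a := j)" \<kappa>, OF this]
    have K: "?K - {R a} = ?K" "finite ?K" by auto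
    show "(if barbell_proper a 0 0 (\<kappa>(R a := j))
          \<and> (\<kappa>(R a := j)) (barbell_path_vertex a 0) = i
        then \<Prod>v\<in>insert (R a) ?K. x ((\<kappa>(R a := j)) v) else 0)
      = (if j = i then x i * (if inj_on \<kappa> ?K \<and> i \<notin> \<kappa> ` ?K then \<Prod>v\<in>?K. x (\<kappa> v) else 0) else 0)"
      unfolding barbell_proper_def V(2) inj_on_insert prod.insert[OF K(2) V(3)] K(1)
      using agree(1,2) agree(3)[of x] by (cases "j = i") (simp_all add: barbell_path_vertex_def)
  qed
  also have "\<dots> = (\<Sum>j\<in>C. if j = i then x i * (\<Sum>\<kappa>\<in>?K \<rightarrow>\<^sub>E C.
        if inj_on \<kappa> ?K \<and> i \<notin> \<kappa> ` ?K then \<Prod>v\<in>?K. x (\<kappa> v) else 0) else 0)"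
    by (intro sum.cong refl) (simp add: sum_distrib_left)
  also have "\<dots> = x i * (of_nat (fact (a - 1)) * esym x (C - {i}) (a - 1))"
    using inner assms(1) 0 by (simp only: sum.delta if_True)
  finally show ?case by (simp add: algebra_simps)
next
  case (Suc b)
  let ?s = "S (Suc b)" and ?V = "barbell_verts a b 0" and ?p = "barbell_path_vertex a"
  have V: "barbell_verts a (Suc b) 0 = insert ?s ?V" "?s \<notin> ?V"
    by (auto simp: barbell_verts_def atLeastAtMostSuc_conv)
  have p: "?p (Suc b) = ?s" by (simp add: barbell_path_vertex_def)
  \<comment> \<open>The condition on the new edge becomes a 0/1 factor, so that
    \<open>sum_PiE_by_color\<close> can take it for \<open>h\<close>.\<close>
  have "(\<Sum>\<kappa>\<in>barbell_verts a (Suc b) 0 \<rightarrow>\<^sub>E C.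
      if barbell_proper a (Suc b) 0 \<kappa> \<and> \<kappa> (?p (Suc b)) = i
      then \<Prod>v\<in>barbell_verts a (Suc b) 0. x (\<kappa> v) else 0)
    = (\<Sum>j\<in>C. \<Sum>\<kappa>\<in>?V \<rightarrow>\<^sub>E C. if j = i
        then x i * (if barbell_proper a b 0 \<kappa>
          then (\<Prod>v\<in>?V. x (\<kappa> v)) * (if \<kappa> (?p b) \<noteq> i then 1 else 0) else 0) else 0)"
    unfolding V(1) sum_PiE_insert[OF V(2)]
  proof (intro sum.cong refl)
    fix j :: 'c and \<kappa> :: "barbell_vertex \<Rightarrow> 'c"
    have eq: "\<And>v. v \<in> ?V \<Longrightarrow> (\<kappa>(?s := j)) v = \<kappa> v" using V(2) by auto
    have prod: "(\<Prod>v\<in>?V. x ((\<kappa>(?s := j)) v)) = (\<Prod>v\<in>?V. x (\<kappa> v))"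
      using eq by (auto cong: prod.cong)
    have "barbell_proper a (Suc b) 0 (\<kappa>(?s := j))
        \<longleftrightarrow> barbell_proper a b 0 (\<kappa>(?s := j)) \<and> (\<kappa>(?s := j)) (?p b) \<noteq> j"
      by (simp add: barbell_proper_Suc p)
    also have "\<dots> \<longleftrightarrow> barbell_proper a b 0 \<kappa> \<and> \<kappa> (?p b) \<noteq> j"
      using barbell_proper_cong[of a b 0 "\<kappa>(?s := j)" \<kappa>, OF assms(2) eq] eq[OF barbell_path_vertex_mem[OF assms(2)], of b]
      by auto
    finally show "(if barbell_proper a (Suc b) 0 (\<kappa>(?s := j)) \<and> (\<kappa>(?s := j)) (?p (Suc b)) = i
        then \<Prod>v\<in>insert ?s ?V. x ((\<kappa>(?s := j)) v) else 0)
      = (if j = i then x i * (if barbell_proper a b 0 \<kappa>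
          then (\<Prod>v\<in>?V. x (\<kappa> v)) * (if \<kappa> (?p b) \<noteq> i then 1 else 0) else 0) else 0)"
      using V(2) prod by (auto simp: p finite_barbell_verts)
  qed
  also have "\<dots> = (\<Sum>j\<in>C. if j = i then x i * (\<Sum>\<kappa>\<in>?V \<rightarrow>\<^sub>E C. if barbell_proper a b 0 \<kappa>
          then (\<Prod>v\<in>?V. x (\<kappa> v)) * (if \<kappa> (?p b) \<noteq> i then 1 else 0) else 0) else 0)"
    by (intro sum.cong refl) (simp add: sum_distrib_left)
  also have "\<dots> = x i * (\<Sum>\<kappa>\<in>?V \<rightarrow>\<^sub>E C. if barbell_proper a b 0 \<kappa>
          then (\<Prod>v\<in>?V. x (\<kappa> v)) * (if \<kappa> (?p b) \<noteq> i then 1 else 0) else 0)"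
    using assms Suc.prems by simp
  also have "(\<Sum>\<kappa>\<in>?V \<rightarrow>\<^sub>E C. if barbell_proper a b 0 \<kappa>
          then (\<Prod>v\<in>?V. x (\<kappa> v)) * (if \<kappa> (?p b) \<noteq> i then 1 else 0) else 0)
      = (\<Sum>j\<in>C. (of_nat (fact (a - 1)) * lollipop_sum x C a b j) * (if j \<noteq> i then 1 else 0))"
    using barbell_path_vertex_mem[OF assms(2), of b b 0]
    by (subst sum_PiE_by_color[OF assms(1)]) (simp_all add: Suc.IH)
  also have "\<dots> = (\<Sum>j\<in>C - {i}. of_nat (fact (a - 1)) * lollipop_sum x C a b j)"
    using assms by (intro sum.mono_neutral_cong_right) auto
  finally show ?case by (simp add: mult.left_commute flip: sum_distrib_left)
qed

text \<open>The \<open>T\<close> vertices meet the rest only in the last path vertex. Once that has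
  colour \<open>i\<close>, they carry distinct colours from \<open>C - {i}\<close>, which
  contributes \<open>fact c * esym x (C - {i}) c\<close>.\<close>

lemma barbell_sum_eq:
  fixes x :: "'c \<Rightarrow> 'a::comm_ring_1"
  assumes "finite C" "a \<ge> 1"
  shows "barbell_sum x C a b c
    = of_nat (fact (a - 1) * fact c) * (\<Sum>i\<in>C. lollipop_sum x C a b i * esym x (C - {i}) c)"
proof -
  let ?V = "barbell_verts a b 0" and ?T = "T ` {1..c}" and ?p = "barbell_path_vertex a b"
  have V: "barbell_verts a b c = ?V \<union> ?T" and disj: "?V \<inter> ?T = {}"
    by (auto simp: barbell_verts_def)
  have card: "card ?T = c" by (simp add: card_image inj_on_def)
  have "finite ?T" by simp
  note inner = sum_injective_colorings_avoiding[OF this assms(1), where x = x, unfolded card]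
  have p: "?p \<in> ?V" by (rule barbell_path_vertex_mem[OF assms(2)]) simp
  have "barbell_sum x C a b c = (\<Sum>\<alpha>\<in>?V \<rightarrow>\<^sub>E C. \<Sum>\<beta>\<in>?T \<rightarrow>\<^sub>E C.
      if barbell_proper a b 0 \<alpha> then (\<Prod>v\<in>?V. x (\<alpha> v)) *
        (if inj_on \<beta> ?T \<and> \<alpha> ?p \<notin> \<beta> ` ?T then \<Prod>v\<in>?T. x (\<beta> v) else 0) else 0)"
    unfolding barbell_sum_def V sum_PiE_Un[OF disj]
  proof (intro sum.cong refl)
    fix \<alpha> \<beta> :: "barbell_vertex \<Rightarrow> 'c"
    let ?\<kappa> = "\<lambda>v. if v \<in> ?V then \<alpha> v else \<beta> v"
    have \<beta>: "\<And>v. v \<in> ?T \<Longrightarrow> ?\<kappa> v = \<beta> v" using disj by auto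
    note T = colorings_agree[of ?T ?\<kappa> \<beta>, OF \<beta>]
    have prod: "(\<Prod>v\<in>?V \<union> ?T. x (?\<kappa> v)) = (\<Prod>v\<in>?V. x (\<alpha> v)) * (\<Prod>v\<in>?T. x (\<beta> v))"
      using disj T(3)[where x = x]
      by (subst prod.union_disjoint) (auto simp: finite_barbell_verts)
    have "?p \<notin> ?T" using p disj by auto
    \<comment> \<open>\<open>inj_on_insert\<close> removes the inserted point from the set, which
      changes nothing here.\<close>
    then have "?T - {?p} = ?T" by auto
    then have "barbell_proper a b c ?\<kappa>
        \<longleftrightarrow> barbell_proper a b 0 ?\<kappa> \<and> inj_on ?\<kappa> ?T \<and> ?\<kappa> ?p \<notin> ?\<kappa> ` ?T"
      by (simp add: barbell_proper_def inj_on_insert)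
    also have "barbell_proper a b 0 ?\<kappa> \<longleftrightarrow> barbell_proper a b 0 \<alpha>"
      by (rule barbell_proper_cong[OF assms(2)]) simp
    also note T(1)
    also note T(2)
    also have "?\<kappa> ?p = \<alpha> ?p" using p by simp
    finally show "(if barbell_proper a b c ?\<kappa> then \<Prod>v\<in>?V \<union> ?T. x (?\<kappa> v) else 0)
      = (if barbell_proper a b 0 \<alpha> then (\<Prod>v\<in>?V. x (\<alpha> v)) *
        (if inj_on \<beta> ?T \<and> \<alpha> ?p \<notin> \<beta> ` ?T then \<Prod>v\<in>?T. x (\<beta> v) else 0) else 0)"
      unfolding prod by simp
  qed
  also have "\<dots> = (\<Sum>\<alpha>\<in>?V \<rightarrow>\<^sub>E C. if barbell_proper a b 0 \<alpha> then (\<Prod>v\<in>?V. x (\<alpha> v)) *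
        (\<Sum>\<beta>\<in>?T \<rightarrow>\<^sub>E C. if inj_on \<beta> ?T \<and> \<alpha> ?p \<notin> \<beta> ` ?T then \<Prod>v\<in>?T. x (\<beta> v) else 0) else 0)"
    by (intro sum.cong refl) (simp add: sum_distrib_left)
  also have "\<dots> = (\<Sum>\<alpha>\<in>?V \<rightarrow>\<^sub>E C. if barbell_proper a b 0 \<alpha> then (\<Prod>v\<in>?V. x (\<alpha> v)) *
        (of_nat (fact c) * esym x (C - {\<alpha> ?p}) c) else 0)"
    unfolding inner ..
  also have "\<dots> = (\<Sum>i\<in>C. (of_nat (fact (a - 1)) * lollipop_sum x C a b i)
        * (of_nat (fact c) * esym x (C - {i}) c))"
    by (subst sum_PiE_by_color[OF assms(1) p])
       (simp add: lollipop_coloring_sum[OF assms])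
  finally show ?thesis by (simp add: sum_distrib_left algebra_simps)
qed

text \<open>The new value at \<open>i\<close> is \<open>x i\<close> times the total \<open>W\<close>
  minus the old value at \<open>i\<close>. Summation turns the first part into \<open>Suc c\<close>
  copies of \<open>esym x C (Suc c) * W\<close>, and the second takes one copy away, whence the
  factor \<open>c\<close>.\<close>

lemma sum_lollipop_esym_Suc:
  fixes x :: "'c \<Rightarrow> 'a::comm_ring_1"
  assumes "finite C"
  shows "(\<Sum>i\<in>C. lollipop_sum x C a (Suc b) i * esym x (C - {i}) c)
    = (\<Sum>i\<in>C. lollipop_sum x C a b i * esym x (C - {i}) (Suc c))
      + of_nat c * (esym x C (Suc c) * (\<Sum>i\<in>C. lollipop_sum x C a b i * esym x (C - {i}) 0))"
proof -
  define W where "W = (\<Sum>i\<in>C. lollipop_sum x C a b i)"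
  have "(\<Sum>i\<in>C. lollipop_sum x C a (Suc b) i * esym x (C - {i}) c)
     = (\<Sum>i\<in>C. x i * esym x (C - {i}) c * W - lollipop_sum x C a b i * esym x C (Suc c)
          + lollipop_sum x C a b i * esym x (C - {i}) (Suc c))"
    by (rule sum.cong)
       (simp_all add: W_def assms sum_diff1 esym_Suc_remove[OF assms, of _ x c] algebra_simps)
  also have "\<dots> = of_nat (Suc c) * esym x C (Suc c) * W - W * esym x C (Suc c)
      + (\<Sum>i\<in>C. lollipop_sum x C a b i * esym x (C - {i}) (Suc c))"
    by (simp only: sum.distrib sum_subtractf sum_var_esym_remove[OF assms] W_def
        flip: sum_distrib_right)
  \<comment> \<open>Since e_0 = 1, \<open>W\<close> is itself a sum of the same kind, for
    \<open>c = 0\<close>, so the recursion closes.\<close>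
  also have "W = (\<Sum>i\<in>C. lollipop_sum x C a b i * esym x (C - {i}) 0)"
    using assms by (simp add: W_def esym_0)
  finally show ?thesis by (simp add: algebra_simps)
qed

subsection \<open>The sum over compositions\<close>

text \<open>The coefficient of \<open>e\<^sub>I\<close> in the expansion, with the two sums of the theorem merged.\<close>

definition barbell_coeff :: "nat \<Rightarrow> nat \<Rightarrow> nat list \<Rightarrow> int" where
  "barbell_coeff a c I =
     (if last I < a then 0
      else if c < hd I then comp_weight I
      else if 2 \<le> length I \<and> c < I ! 1
        then (int (I ! 1) - int (hd I)) * (\<Prod>i\<leftarrow>drop 2 I. int i - 1)
      else 0)"

definition barbell_expansion :: "(nat \<Rightarrow> 'a::comm_ring_1) \<Rightarrow> nat \<Rightarrow> nat \<Rightarrow> nat \<Rightarrow> 'a" where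
  "barbell_expansion e a c n =
     (\<Sum>I\<in>compositions n. of_int (barbell_coeff a c I) * (\<Prod>i\<leftarrow>I. e i))"

text \<open>The counterpart of \<open>sum_lollipop_esym_Suc\<close> for compositions. Each
  \<open>J\<close> in \<open>compositions m\<close> arises in two ways, by deleting a part
  \<open>Suc c\<close> from first or from second place, and the two changes of coefficient
  combine.\<close>

lemma barbell_expansion_Suc:
  fixes e :: "nat \<Rightarrow> 'a::comm_ring_1"
  assumes "1 \<le> a" "a \<le> m"
  shows "barbell_expansion e a c (Suc c + m) =
    barbell_expansion e a (Suc c) (Suc c + m) + of_nat c * (e (Suc c) * barbell_expansion e a 0 m)"
proof -
  let ?n = "Suc c + m"
  let ?e = "\<lambda>I. \<Prod>i\<leftarrow>I. e i"
  \<comment> \<open>Splitting by the first part makes a composition that begins with two parts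
    \<open>Suc c\<close> count only once, in \<open>\<delta>1\<close>.\<close>
  define \<delta>1 where "\<delta>1 I = (if hd I = Suc c then barbell_coeff a c I - barbell_coeff a (Suc c) I else 0)"
    for I
  define \<delta>2 where "\<delta>2 I = (if hd I \<noteq> Suc c then barbell_coeff a c I - barbell_coeff a (Suc c) I else 0)"
    for I
  define ins2 where "ins2 J = hd J # Suc c # tl J" for J :: "nat list"
  have ne: "J \<noteq> []" if "J \<in> compositions m" for J
    using that assms by (auto simp: compositions_def)
  have ne': "I \<noteq> []" if "I \<in> compositions ?n" for I
    using that by (auto simp: compositions_def)
  have fin: "finite (compositions ?n)" by (rule finite_compositions)

  have sub1: "(#) (Suc c) ` compositions m \<subseteq> compositions ?n"
    by (auto simp: compositions_def)
  have zero1: "\<delta>1 I = 0" if "I \<in> compositions ?n - (#) (Suc c) ` compositions m" for I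
  proof (rule ccontr)
    assume "\<delta>1 I \<noteq> 0"
    then have "I = Suc c # tl I" using that ne'[of I] by (cases I) (auto simp: \<delta>1_def)
    moreover from this have "tl I \<in> compositions m"
      using that by (cases I) (auto simp: compositions_def)
    ultimately show False using that by blast
  qed
  have sum1: "(\<Sum>I\<in>compositions ?n. of_int (\<delta>1 I) * ?e I)
      = (\<Sum>J\<in>compositions m. of_int (\<delta>1 (Suc c # J)) * (e (Suc c) * ?e J))"
  proof -
    have "(\<Sum>I\<in>compositions ?n. of_int (\<delta>1 I) * ?e I)
        = (\<Sum>I\<in>(#) (Suc c) ` compositions m. of_int (\<delta>1 I) * ?e I)"
      using fin sub1 zero1 by (intro sum.mono_neutral_right) auto
    also have "\<dots> = (\<Sum>J\<in>compositions m. of_int (\<delta>1 (Suc c # J)) * (e (Suc c) * ?e J))"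
      by (subst sum.reindex) auto
    finally show ?thesis .
  qed

  have sub2: "ins2 ` compositions m \<subseteq> compositions ?n"
  proof
    fix I assume "I \<in> ins2 ` compositions m"
    then obtain J where "J \<in> compositions m" "I = ins2 J" by auto
    then show "I \<in> compositions ?n"
      using ne[of J] by (cases J) (auto simp: ins2_def compositions_def)
  qed
  have inj2: "inj_on ins2 (compositions m)"
    using ne by (intro inj_onI) (metis ins2_def list.collapse list.inject)
  have zero2: "\<delta>2 I = 0" if mem: "I \<in> compositions ?n - ins2 ` compositions m" for I
  proof (rule ccontr)
    assume *: "\<delta>2 I \<noteq> 0"
    obtain i I' where I: "I = i # I'" using mem ne'[of I] by (cases I) auto
    \<comment> \<open>As the first part is not \<open>Suc c\<close>, comparing it with
      \<open>c\<close> or with \<open>Suc c\<close> gives the same result; only the test on the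
      second part can change.\<close>
    with * obtain K where "I' = Suc c # K"
      by (cases I') (auto simp: \<delta>2_def barbell_coeff_def split: if_splits)
    with I have "I = ins2 (i # K)" "i # K \<in> compositions m"
      using that by (auto simp: ins2_def compositions_def)
    then show False using that by blast
  qed
  have sum2: "(\<Sum>I\<in>compositions ?n. of_int (\<delta>2 I) * ?e I)
      = (\<Sum>J\<in>compositions m. of_int (\<delta>2 (ins2 J)) * (e (Suc c) * ?e J))"
  proof -
    have "(\<Sum>I\<in>compositions ?n. of_int (\<delta>2 I) * ?e I)
        = (\<Sum>I\<in>ins2 ` compositions m. of_int (\<delta>2 I) * ?e I)"
      using fin sub2 zero2 by (intro sum.mono_neutral_right) auto
    also have "\<dots> = (\<Sum>J\<in>compositions m. of_int (\<delta>2 (ins2 J)) * ?e (ins2 J))"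
      by (subst sum.reindex[OF inj2]) auto
    also have "\<dots> = (\<Sum>J\<in>compositions m. of_int (\<delta>2 (ins2 J)) * (e (Suc c) * ?e J))"
    proof (rule sum.cong)
      fix J assume "J \<in> compositions m"
      then show "of_int (\<delta>2 (ins2 J)) * ?e (ins2 J) = of_int (\<delta>2 (ins2 J)) * (e (Suc c) * ?e J)"
        using ne[of J] by (cases J) (auto simp: ins2_def algebra_simps)
    qed simp
    finally show ?thesis .
  qed

  \<comment> \<open>Let J = j # K have last part at least a, and let P be the product of i - 1 over
    K. If j > c + 1, the terms are ((c+1)(j-1) - (j-c-1))P and 0; otherwise they are (c+1)(j-1)P and
    (c+1-j)P. Both sums are cjP.\<close>
  have key: "\<delta>1 (Suc c # J) + \<delta>2 (ins2 J) = int c * barbell_coeff a 0 J" if J: "J \<in> compositions m" for J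
  proof -
    obtain j K where JK: "J = j # K" using ne[OF J] by (cases J) auto
    have j: "j \<ge> 1" using J by (auto simp: JK compositions_def)
    show ?thesis
    proof (cases "K = []")
      \<comment> \<open>Here \<open>ins2\<close> makes \<open>Suc c\<close> the last part. Its
        coefficient can change only if m \<le> c, and then c + 1 > m \<ge> a, so the bound on the
        last part still holds.\<close>
      case True
      then have "j = m" using J by (auto simp: JK compositions_def)
      then show ?thesis using assms j True
        by (auto simp: JK \<delta>1_def \<delta>2_def ins2_def barbell_coeff_def comp_weight_def algebra_simps)
    next
      case False
      then show ?thesis using j
        by (auto simp: JK \<delta>1_def \<delta>2_def ins2_def barbell_coeff_def comp_weight_def algebra_simps)
    qed
  qed

  have "barbell_expansion e a c ?n - barbell_expansion e a (Suc c) ?n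
      = (\<Sum>I\<in>compositions ?n. of_int (\<delta>1 I) * ?e I + of_int (\<delta>2 I) * ?e I)"
    unfolding barbell_expansion_def sum_subtractf[symmetric]
    by (rule sum.cong) (auto simp: \<delta>1_def \<delta>2_def algebra_simps)
  also have "\<dots> = (\<Sum>J\<in>compositions m. of_int (\<delta>1 (Suc c # J) + \<delta>2 (ins2 J)) * (e (Suc c) * ?e J))"
    by (simp only: sum.distrib sum1 sum2 of_int_add distrib_right)
  also have "\<dots> = (\<Sum>J\<in>compositions m. of_nat c * (e (Suc c) * (of_int (barbell_coeff a 0 J) * ?e J)))"
    by (intro sum.cong refl) (simp add: key mult_ac del: of_int_add)
  also have "\<dots> = of_nat c * (e (Suc c) * barbell_expansion e a 0 m)"
    by (simp add: barbell_expansion_def sum_distrib_left)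
  finally show ?thesis by (simp add: algebra_simps)
qed

text \<open>With n = a + c, a last part at least a leaves at most c for all the others. So the first
  case of \<open>barbell_coeff\<close> admits only \<open>[n]\<close>, the second only
  \<open>[r, n - r]\<close>, where n - r \<ge> a means r \<le> c and n - r > c means r < a.\<close>

lemma barbell_expansion_base:
  fixes e :: "nat \<Rightarrow> 'a::comm_ring_1"
  assumes "1 \<le> a"
  shows "barbell_expansion e a c (a + c) = of_nat (a + c) * e (a + c)
    + (\<Sum>r = 1..min c (a - 1). of_int (int (a + c) - 2 * int r) * (e r * e (a + c - r)))"
proof -
  let ?n = "a + c" and ?Q = "{1..min c (a - 1)}"
  let ?f = "\<lambda>I. of_int (barbell_coeff a c I) * (\<Prod>i\<leftarrow>I. e i)"
  let ?g = "\<lambda>r. [r, ?n - r]"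
  have zero: "barbell_coeff a c I = 0" if I: "I \<in> compositions ?n" "I \<notin> insert [?n] (?g ` ?Q)" for I
  proof (rule ccontr)
    assume nz: "barbell_coeff a c I \<noteq> 0"
    obtain i I' where i: "I = i # I'" using I assms by (cases I) (auto simp: compositions_def)
    have "I' \<noteq> []" using I by (auto simp: i compositions_def)
    then obtain j K where j: "I' = j # K" by (cases I') auto
    have pos: "i \<ge> 1" "j \<ge> 1" and sum: "i + j + sum_list K = ?n"
      using I by (auto simp: i j compositions_def)
    show False
    proof (cases "K = []")
      case True
      then have "I \<in> ?g ` ?Q" if "i \<le> c" "i < a"
        using that sum pos by (auto simp: i j image_iff intro!: bexI[of _ i])
      then show False using I nz True sum
        by (auto simp: i j barbell_coeff_def split: if_splits)
    next
      case False
      \<comment> \<open>With three or more parts, the last is at least a and the first or second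
        exceeds c, so the total exceeds a + c.\<close>
      then have "last K \<le> sum_list K" by (intro member_le_sum_list) auto
      then show False using nz False sum pos
        by (auto simp: i j barbell_coeff_def split: if_splits)
    qed
  qed
  have "barbell_expansion e a c ?n = (\<Sum>I\<in>insert [?n] (?g ` ?Q). ?f I)"
    unfolding barbell_expansion_def
    using assms zero finite_compositions
    by (intro sum.mono_neutral_right) (auto simp: compositions_def)
  also have "\<dots> = ?f [?n] + (\<Sum>I\<in>?g ` ?Q. ?f I)"
    by (rule sum.insert) auto
  also have "(\<Sum>I\<in>?g ` ?Q. ?f I) = (\<Sum>r\<in>?Q. ?f (?g r))"
    by (subst sum.reindex) (auto simp: inj_on_def)
  also have "\<dots> = (\<Sum>r\<in>?Q. of_int (int ?n - 2 * int r) * (e r * e (?n - r)))"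
    using assms by (intro sum.cong refl) (auto simp: barbell_coeff_def of_nat_diff)
  also have "?f [?n] = of_nat ?n * e ?n"
    using assms by (simp add: barbell_coeff_def comp_weight_def)
  finally show ?thesis .
qed

text \<open>Both sides obey the same recursion in \<open>b\<close>, which raises \<open>c\<close> or
  resets it to 0; hence \<open>c\<close> varies in the induction.\<close>

lemma sum_lollipop_esym_eq_expansion:
  fixes x :: "'c \<Rightarrow> 'a::comm_ring_1"
  assumes "finite C" "1 \<le> a"
  shows "(\<Sum>i\<in>C. lollipop_sum x C a b i * esym x (C - {i}) c)
    = barbell_expansion (esym x C) a c (a + b + c)"
proof (induction b arbitrary: c)
  case 0
  \<comment> \<open>The sum is symmetric in the two indices \<open>a - 1\<close> and
    \<open>c\<close>; taking the smaller as \<open>q\<close> makes the range of \<open>r\<close>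
    match \<open>barbell_expansion_base\<close>.\<close>
  have *: "(\<Sum>i\<in>C. x i * esym x (C - {i}) p * esym x (C - {i}) q)
      = barbell_expansion (esym x C) a c (a + c)"
    if "p + q + 1 = a + c" "q = min c (a - 1)" for p q
    unfolding sum_var_esym_esym_remove[OF assms(1)] barbell_expansion_base[OF assms(2)] that(1)
    by (simp add: that(2))
  show ?case
  proof (cases "c \<le> a - 1")
    case True
    then show ?thesis using *[of "a - 1" c] assms by simp
  next
    case False
    then show ?thesis using *[of c "a - 1"] assms by (simp add: mult.assoc mult.commute mult.left_commute)
  qed
next
  case (Suc b)
  show ?case
    unfolding sum_lollipop_esym_Suc[OF assms(1)] Suc.IH
    using barbell_expansion_Suc[OF assms(2), of "a + b" "esym x C" c]
    by (simp add: algebra_simps)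
qed

subsection \<open>From finitely many to all colours\<close>

text \<open>Equality after setting all variables outside \<open>D\<close> to 0.\<close>

definition agree_on :: "nat set \<Rightarrow> 'a mseries \<Rightarrow> 'a mseries \<Rightarrow> bool" where
  "agree_on D f g \<longleftrightarrow> (\<forall>M. set_mset M \<subseteq> D \<longrightarrow> mcoeff f M = mcoeff g M)"

lemma agree_on_refl: "agree_on D f f"
  by (simp add: agree_on_def)

text \<open>Every divisor of a monomial in variables from \<open>D\<close> is again such a
  monomial.\<close>

lemma agree_on_mult:
  fixes f g f' g' :: "'a::comm_ring_1 mseries"
  assumes "agree_on D f f'" "agree_on D g g'"
  shows "agree_on D (f * g) (f' * g')"
  unfolding agree_on_def times_mseries.rep_eq
proof (intro allI impI sum.cong refl)
  fix M P :: "nat multiset" assume M: "set_mset M \<subseteq> D" and "P \<in> {P. P \<subseteq># M}"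
  then have "set_mset P \<subseteq> D" "set_mset (M - P) \<subseteq> D"
    by (auto dest: mset_subset_eqD in_diffD)
  then show "mcoeff f P * mcoeff g (M - P) = mcoeff f' P * mcoeff g' (M - P)"
    using assms by (simp add: agree_on_def)
qed

lemma mcoeff_sum:
  "mcoeff (\<Sum>i\<in>A. f i :: 'a::comm_ring_1 mseries) M = (\<Sum>i\<in>A. mcoeff (f i) M)"
  by (induction A rule: infinite_finite_induct) (simp_all add: zero_mseries.rep_eq plus_mseries.rep_eq)

lemma agree_on_sum:
  fixes f g :: "'i \<Rightarrow> 'a::comm_ring_1 mseries"
  assumes "\<And>i. i \<in> A \<Longrightarrow> agree_on D (f i) (g i)"
  shows "agree_on D (\<Sum>i\<in>A. f i) (\<Sum>i\<in>A. g i)"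
  using assms by (simp add: agree_on_def mcoeff_sum)

lemma agree_on_prod_list:
  fixes f g :: "'i \<Rightarrow> 'a::comm_ring_1 mseries"
  assumes "\<And>i. agree_on D (f i) (g i)"
  shows "agree_on D (\<Prod>i\<leftarrow>I. f i) (\<Prod>i\<leftarrow>I. g i)"
  by (induction I) (simp_all add: assms agree_on_refl agree_on_mult)

text \<open>Only index sets inside \<open>D\<close> produce monomials over \<open>D\<close>. The
  intersection with \<open>{1..}\<close> is there because variable 0 exists but is not a
  colour.\<close>

lemma elem_sym_agree:
  assumes "finite D"
  shows "agree_on D (elem_sym k :: 'a::comm_ring_1 mseries) (esym var (D \<inter> {1..}) k)"
  unfolding agree_on_def elem_sym_def esym_def formal_sum.rep_eq mcoeff_sum
proof (intro allI impI sum.mono_neutral_left)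
  fix M :: "nat multiset" assume "set_mset M \<subseteq> D"
  then show "{A \<in> {A. A \<subseteq> {1..} \<and> finite A \<and> card A = k}.
        mcoeff (\<Prod>i\<in>A. var i :: 'a mseries) M \<noteq> 0} \<subseteq> {A. A \<subseteq> D \<inter> {1..} \<and> card A = k}"
    by (auto simp: prod_var_eq split: if_splits)
qed (use assms in \<open>auto intro: finite_subset\<close>)

text \<open>A colouring that uses a colour outside \<open>D\<close> yields a monomial outside
  \<open>D\<close>, so finitely many colourings suffice.\<close>

lemma chromatic_sym_barbell_agree:
  assumes "finite D" "a \<ge> 1"
  shows "agree_on D
    (chromatic_sym (barbell_verts a b c) (barbell_edges a b c) :: 'a::comm_ring_1 mseries)
    (barbell_sum var (D \<inter> {1..}) a b c)"
  unfolding agree_on_def chromatic_sym_def barbell_sum_def formal_sum.rep_eq mcoeff_sum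
proof (intro allI impI sum.mono_neutral_cong_left)
  let ?V = "barbell_verts a b c" and ?E = "barbell_edges a b c"
  fix M :: "nat multiset" assume M: "set_mset M \<subseteq> D"
  show "finite (?V \<rightarrow>\<^sub>E D \<inter> {1..})"
    using assms by (intro finite_PiE) (auto simp: finite_barbell_verts)
  show "{\<kappa> \<in> proper_colorings ?V ?E. mcoeff (\<Prod>v\<in>?V. var (\<kappa> v) :: 'a mseries) M \<noteq> 0}
      \<subseteq> ?V \<rightarrow>\<^sub>E D \<inter> {1..}"
    using M by (auto simp: proper_colorings_def prod_var_eq finite_barbell_verts PiE_def Pi_def
        split: if_splits)
  fix \<kappa>
  assume "\<kappa> \<in> {\<kappa> \<in> proper_colorings ?V ?E. mcoeff (\<Prod>v\<in>?V. var (\<kappa> v) :: 'a mseries) M \<noteq> 0}"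
  then show "mcoeff (\<Prod>v\<in>?V. var (\<kappa> v) :: 'a mseries) M
      = mcoeff (if barbell_proper a b c \<kappa> then \<Prod>v\<in>?V. var (\<kappa> v) else 0) M"
    unfolding proper_colorings_def barbell_proper_iff[OF assms(2)] by simp
next
  let ?V = "barbell_verts a b c" and ?E = "barbell_edges a b c"
  fix M :: "nat multiset"
  show "\<forall>\<kappa>\<in>(?V \<rightarrow>\<^sub>E D \<inter> {1..})
      - {\<kappa> \<in> proper_colorings ?V ?E. mcoeff (\<Prod>v\<in>?V. var (\<kappa> v) :: 'a mseries) M \<noteq> 0}.
      mcoeff (if barbell_proper a b c \<kappa> then \<Prod>v\<in>?V. var (\<kappa> v) else 0 :: 'a mseries) M = 0"
    unfolding proper_colorings_def barbell_proper_iff[OF assms(2)]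
    by (auto simp: zero_mseries.rep_eq PiE_def Pi_def)
qed

section \<open>Separating the two sums and comparing coefficients\<close>

lemma sum_barbell_coeff:
  fixes g :: "nat list \<Rightarrow> 'a::comm_ring_1"
  shows "(\<Sum>I\<in>compositions n. of_int (barbell_coeff a c I) * g I)
    = (\<Sum>I | I \<in> compositions n \<and> last I \<ge> a \<and> hd I \<ge> c + 1. of_int (comp_weight I) * g I)
     + (\<Sum>I | I \<in> compositions n \<and> length I \<ge> 2 \<and> last I \<ge> a \<and> hd I \<le> c \<and> c < I ! 1.
          of_int ((int (I ! 1) - int (hd I)) * (\<Prod>i\<leftarrow>drop 2 I. int i - 1)) * g I)"
    (is "?L = sum ?f ?A + sum ?g ?B")
proof -
  have fin: "finite ?A" "finite ?B"
    by (rule finite_subset[OF _ finite_compositions[of n]]; auto)+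
  have "?L = (\<Sum>I\<in>?A \<union> ?B. of_int (barbell_coeff a c I) * g I)"
    by (rule sum.mono_neutral_right)
       (auto simp: finite_compositions barbell_coeff_def split: if_splits)
  also have "\<dots> = (\<Sum>I\<in>?A. of_int (barbell_coeff a c I) * g I)
      + (\<Sum>I\<in>?B. of_int (barbell_coeff a c I) * g I)"
    by (rule sum.union_disjoint) (use fin in auto)
  also have "(\<Sum>I\<in>?A. of_int (barbell_coeff a c I) * g I) = sum ?f ?A"
    by (rule sum.cong) (auto simp: barbell_coeff_def)
  also have "(\<Sum>I\<in>?B. of_int (barbell_coeff a c I) * g I) = sum ?g ?B"
    by (rule sum.cong) (auto simp: barbell_coeff_def)
  finally show ?thesis .
qed

theorem theorem3p7:
  fixes a b c n :: nat
  assumes "a \<ge> 1" and "n = a + b + c"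
  shows "(chromatic_sym (barbell_verts a b c) (barbell_edges a b c) :: int mseries) =
    of_nat (fact (a - 1) * fact c) *
      ((\<Sum>I | I \<in> compositions n \<and> last I \<ge> a \<and> hd I \<ge> c + 1.
          of_int (comp_weight I) * elem_sym_list I)
     + (\<Sum>I | I \<in> compositions n \<and> length I \<ge> 2 \<and> last I \<ge> a \<and> hd I \<le> c \<and> c < I ! 1.
          of_int ((int (I ! 1) - int (hd I)) * (\<Prod>i\<leftarrow>drop 2 I. int i - 1)) * elem_sym_list I))"
  (is "?X = ?r")
proof (rule mseries_eqI)
  fix M :: "nat multiset"
  let ?D = "set_mset M"
  let ?C = "?D \<inter> {1..}"
  \<comment> \<open>For the single monomial \<open>M\<close>, its own variables are enough colours;
    both sides are compared with the finite barbell sum over \<open>?C\<close>.\<close>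
  have "agree_on ?D ?r (of_nat (fact (a - 1) * fact c) * barbell_expansion (esym var ?C) a c n)"
    unfolding sum_barbell_coeff[symmetric] barbell_expansion_def elem_sym_list_def
    by (intro agree_on_mult agree_on_sum agree_on_prod_list agree_on_refl elem_sym_agree) simp
  then have "agree_on ?D ?r (barbell_sum var ?C a b c)"
    using assms by (simp add: barbell_sum_eq sum_lollipop_esym_eq_expansion)
  moreover have "agree_on ?D ?X (barbell_sum var ?C a b c)"
    by (rule chromatic_sym_barbell_agree) (use assms in auto)
  ultimately show "mcoeff ?X M = mcoeff ?r M"
    by (simp add: agree_on_def)
qed

end
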